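(* Let $G$ and $H$ be finite simple connected graphs. If the strong product $G\boxtimes H$ is a distance-regular (DR) graph, then both $G$ and $H$ are distance-regular graphs.
   Context: All graphs are finite, simple and connected. $\Gamma_i(u)$ is the set of vertices at distance exactly $i$ from $u$. A graph is distance-regular (DR) if for all $i,j$ the number $|\Gamma_i(u)\cap\Gamma_j(v)|$ depends only on $i$, $j$ and the distance $d(u,v)$, not on the particular vertices $u,v$. The strong product $G\boxtimes H$ has vertex set $V(G)\times V(H)$, and $(g_1,h_1)\sim(g_2,h_2)$ iff ($g_1\sim g_2$ and $h_1=h_2$) or ($g_1=g_2$ and $h_1\sim h_2$) or ($g_1\sim g_2$ and $h_1\sim h_2$). *)

theory Defs
  imports "Graph_Theory.Graph_Theory"
begin

text \<open>
  A finite simple graph is a digraph satisfying \<open>pair_graph\<close> (finite, irreflexive, symmetric arc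
  relation); \<open>connected\<close> is the constant of \<open>Graph_Theory\<close>, which excludes the empty graph.
\<close>

text \<open>
  The graph distance is the library's shortest-path cost with every arc weighing 1;
  it is \<open>\<infinity>\<close> between vertices in different components.
\<close>

definition gdist :: "'a pair_pre_digraph \<Rightarrow> 'a \<Rightarrow> 'a \<Rightarrow> ereal" where
  "gdist G u v = wf_digraph.\<mu> (with_proj G) (\<lambda>_. 1) u v"

definition sphere :: "'a pair_pre_digraph \<Rightarrow> nat \<Rightarrow> 'a \<Rightarrow> 'a set" where
  "sphere G i u = {v \<in> pverts G. gdist G u v = ereal (real i)}"

text \<open>
  The property is meant for finite simple connected graphs; these standing assumptions are
  stated separately and are not part of the definition.
\<close>

definition distance_regular :: "'a pair_pre_digraph \<Rightarrow> bool" where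
  "distance_regular G \<longleftrightarrow>
    (\<forall>i j. \<forall>u \<in> pverts G. \<forall>v \<in> pverts G. \<forall>u' \<in> pverts G. \<forall>v' \<in> pverts G.
       gdist G u v = gdist G u' v' \<longrightarrow>
       card (sphere G i u \<inter> sphere G j v) = card (sphere G i u' \<inter> sphere G j v'))"

definition strong_product ::
  "'a pair_pre_digraph \<Rightarrow> 'b pair_pre_digraph \<Rightarrow> ('a \<times> 'b) pair_pre_digraph" (infixl \<open>\<boxtimes>\<close> 70)
where
  "G \<boxtimes> H = \<lparr> pverts = pverts G \<times> pverts H,
     parcs = {((g1, h1), (g2, h2)) | g1 h1 g2 h2.
       g1 \<in> pverts G \<and> g2 \<in> pverts G \<and> h1 \<in> pverts H \<and> h2 \<in> pverts H \<and>
       ((g1, g2) \<in> parcs G \<and> h1 = h2 \<or>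
        g1 = g2 \<and> (h1, h2) \<in> parcs H \<or>
        (g1, g2) \<in> parcs G \<and> (h1, h2) \<in> parcs H)} \<rparr>"

text \<open>The strong product of finite simple connected graphs is again such a graph.\<close>

lemma pair_graph_strong_product:
  assumes "pair_graph G" "pair_graph H"
  shows "pair_graph (G \<boxtimes> H)"
proof -
  interpret G: pair_graph G by fact
  interpret H: pair_graph H by fact
  have sub: "parcs (G \<boxtimes> H) \<subseteq> (pverts G \<times> pverts H) \<times> (pverts G \<times> pverts H)"
    by (auto simp: strong_product_def)
  have fin: "finite (parcs (G \<boxtimes> H))"
    by (rule finite_subset[OF sub]) (simp add: G.pair_finite_verts H.pair_finite_verts)
  have symG: "(b, a) \<in> parcs G" if "(a, b) \<in> parcs G" for a b
    using G.pair_sym_arcs that by (auto simp: symmetric_def elim: symE)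
  have symH: "(b, a) \<in> parcs H" if "(a, b) \<in> parcs H" for a b
    using H.pair_sym_arcs that by (auto simp: symmetric_def elim: symE)
  show ?thesis
  proof
    show "finite (pverts (G \<boxtimes> H))"
      by (simp add: strong_product_def G.pair_finite_verts H.pair_finite_verts)
    show "symmetric (with_proj (G \<boxtimes> H))"
      by (auto simp: symmetric_def strong_product_def sym_def dest: symG symH)
  qed (use fin G.pair_no_loops H.pair_no_loops in \<open>auto simp: strong_product_def\<close>)
qed

lemma connected_strong_product:
  assumes "pair_graph G" "connected (with_proj G)" "pair_graph H" "connected (with_proj H)"
  shows "connected (with_proj (G \<boxtimes> H))"
proof -
  interpret G: pair_graph G by fact
  interpret H: pair_graph H by fact
  interpret P: pair_graph "G \<boxtimes> H"
    by (rule pair_graph_strong_product) fact+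
  have sG: "strongly_connected (with_proj G)" and sH: "strongly_connected (with_proj H)"
    using G.symmetric_connected_imp_strongly_connected[OF G.pair_sym_arcs assms(2)]
      H.symmetric_connected_imp_strongly_connected[OF H.pair_sym_arcs assms(4)] by auto
  have pv: "pverts (G \<boxtimes> H) = pverts G \<times> pverts H"
    by (simp add: strong_product_def)
  have left: "(a, h) \<rightarrow>\<^sup>*\<^bsub>with_proj (G \<boxtimes> H)\<^esub> (b, h)"
    if "a \<rightarrow>\<^sup>*\<^bsub>with_proj G\<^esub> b" "h \<in> pverts H" for a b h
    using that(1)
  proof (induct rule: G.reachable_induct)
    case base
    with that(2) show ?case
      by (auto intro!: P.reachable_refl simp: pv)
  next
    case (step x y)
    have "((x, h), (y, h)) \<in> parcs (G \<boxtimes> H)"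
      using step(2) that(2) G.wellformed' by (auto simp: strong_product_def)
    then show ?case
      using step P.reachable_adj_trans by simp
  qed
  have right: "(g, a) \<rightarrow>\<^sup>*\<^bsub>with_proj (G \<boxtimes> H)\<^esub> (g, b)"
    if "a \<rightarrow>\<^sup>*\<^bsub>with_proj H\<^esub> b" "g \<in> pverts G" for a b g
    using that(1)
  proof (induct rule: H.reachable_induct)
    case base
    with that(2) show ?case
      by (auto intro!: P.reachable_refl simp: pv)
  next
    case (step x y)
    have "((g, x), (g, y)) \<in> parcs (G \<boxtimes> H)"
      using step(2) that(2) H.wellformed' by (auto simp: strong_product_def)
    then show ?case
      using step P.reachable_adj_trans by simp
  qed
  have "strongly_connected (with_proj (G \<boxtimes> H))"
    unfolding strongly_connected_def
  proof (intro conjI ballI)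
    show "verts (with_proj (G \<boxtimes> H)) \<noteq> {}"
      using sG sH by (auto simp: strongly_connected_def strong_product_def)
  next
    fix u v assume uv: "u \<in> verts (with_proj (G \<boxtimes> H))" "v \<in> verts (with_proj (G \<boxtimes> H))"
    obtain a b c d where [simp]: "u = (a, b)" "v = (c, d)" by (cases u, cases v)
    from uv have mem: "a \<in> pverts G" "c \<in> pverts G" "b \<in> pverts H" "d \<in> pverts H"
      by (auto simp: strong_product_def)
    have "(a, b) \<rightarrow>\<^sup>*\<^bsub>with_proj (G \<boxtimes> H)\<^esub> (c, b)"
      using left mem sG by (auto simp: strongly_connected_def)
    also have "(c, b) \<rightarrow>\<^sup>*\<^bsub>with_proj (G \<boxtimes> H)\<^esub> (c, d)"
      using right mem sH by (auto simp: strongly_connected_def)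
    finally show "u \<rightarrow>\<^sup>*\<^bsub>with_proj (G \<boxtimes> H)\<^esub> v" by simp
  qed
  then show ?thesis
    using P.reachable_mk_symmetric_eq[OF P.pair_sym_arcs]
    by (simp add: connected_def strongly_connected_def mk_symmetric_def)
qed

end

theory Submission
  imports Defs
begin

text \<open>
  Distance-regularity can be tested on balls instead of spheres: a ball is a disjoint union of
  spheres and a sphere is a difference of two balls, so the numbers of common vertices of two
  spheres determine those of two balls and vice versa (\<open>distance_regular_iff_ball\<close>).

  Balls suit the strong product because its distance is the maximum of the two coordinate
  distances (\<open>gdist_strong_product\<close>): a ball of \<open>G \<boxtimes> H\<close> is a product of balls of \<open>G\<close> and \<open>H\<close>.
  Fix a vertex \<open>h\<close> of \<open>H\<close>. The layer \<open>G \<times> {h}\<close> is an isometric copy of \<open>G\<close>, and for \<open>u\<close>, \<open>v\<close>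
  in \<open>G\<close> the balls of radii \<open>i\<close>, \<open>j\<close> around \<open>(u, h)\<close>, \<open>(v, h)\<close> meet in
  \<open>|B\<^sub>i(u) \<inter> B\<^sub>j(v)| \<cdot> |B\<^sub>i(h) \<inter> B\<^sub>j(h)|\<close> vertices. This number depends only on \<open>d(u, v)\<close> when
  the product is distance-regular, and its second factor does not involve \<open>u\<close> and \<open>v\<close>. For positive
  radii \<open>B\<^sub>i(h) \<inter> B\<^sub>j(h)\<close> contains \<open>h\<close>, so that factor cancels, and \<open>G\<close> is distance-regular
  (\<open>distance_regular_of_isometry\<close>). The layers \<open>{g} \<times> H\<close> give the same for \<open>H\<close>.
\<close>


section \<open>Distance and walks with pauses\<close>

lemma nat_or_infinity_eqI:
  assumes x: "x = \<infinity> \<or> (\<exists>n. x = ereal (real n))"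
    and y: "y = \<infinity> \<or> (\<exists>n. y = ereal (real n))"
    and less: "\<And>n. x < ereal (real (Suc n)) \<longleftrightarrow> y < ereal (real (Suc n))"
  shows "x = y"
proof -
  have le: "x \<le> ereal (real n) \<longleftrightarrow> y \<le> ereal (real n)" for n
    using x y less[of n] by auto
  from x show ?thesis
  proof
    assume "x = \<infinity>"
    with y le show ?thesis by auto
  next
    assume "\<exists>n. x = ereal (real n)"
    then obtain n where n: "x = ereal (real n)" ..
    with y le[of n] obtain m where m: "y = ereal (real m)" by auto
    with n le[of n] le[of m] show ?thesis by simp
  qed
qed

text \<open>
  One step of a walk that may also stay where it is. Pauses turn the bound \<open>n\<close> on the length of a walk into
  a number of exactly \<open>n\<close> steps, and they make the relation of a strong product the product of the
  relations of its factors.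
\<close>

definition pausing_step :: "'a pair_pre_digraph \<Rightarrow> ('a \<times> 'a) set" where
  "pausing_step G = {(u, v). u \<in> pverts G \<and> v \<in> pverts G \<and> (u = v \<or> (u, v) \<in> parcs G)}"

context pair_wf_digraph
begin

lemma pausing_step_relpow_iff_awalk:
  assumes "u \<in> pverts G"
  shows "(u, v) \<in> pausing_step G ^^ n \<longleftrightarrow> (\<exists>p. awalk u p v \<and> length p \<le> n)"
  using assms
proof (induct n arbitrary: u)
  case 0
  then show ?case by (auto simp: awalk_Nil_iff)
next
  case (Suc n)
  show ?case
  proof
    assume "(u, v) \<in> pausing_step G ^^ Suc n"
    then obtain w where w: "(u, w) \<in> pausing_step G" "(w, v) \<in> pausing_step G ^^ n"
      using relpow_Suc_D2[of u v n "pausing_step G"] by blast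
    with Suc.hyps[of w] obtain p where p: "awalk w p v" "length p \<le> n"
      by (auto simp: pausing_step_def)
    show "\<exists>p. awalk u p v \<and> length p \<le> Suc n"
    proof (cases "u = w")
      case True
      with p show ?thesis by (intro exI[of _ p]) auto
    next
      case False
      with w have "(u, w) \<in> parcs G" by (simp add: pausing_step_def)
      with p show ?thesis
        by (intro exI[of _ "(u, w) # p"]) (auto simp: awalk_Cons_iff)
    qed
  next
    assume "\<exists>p. awalk u p v \<and> length p \<le> Suc n"
    then obtain p where p: "awalk u p v" "length p \<le> Suc n" by blast
    show "(u, v) \<in> pausing_step G ^^ Suc n"
    proof (cases p)
      case Nil
      with p Suc have "(u, v) \<in> pausing_step G ^^ n"
        by (metis le0 list.size(3))
      moreover have "(u, u) \<in> pausing_step G"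
        using Suc.prems by (simp add: pausing_step_def)
      ultimately show ?thesis by (blast intro: relpow_Suc_I2)
    next
      case (Cons e q)
      with p have e: "e \<in> parcs G" "u = fst e" and q: "awalk (snd e) q v" "length q \<le> n"
        by (auto simp: awalk_Cons_iff)
      have verts: "fst e \<in> pverts G" "snd e \<in> pverts G"
        using e arc_fst_in_verts arc_snd_in_verts by blast+
      with q Suc.hyps have "(snd e, v) \<in> pausing_step G ^^ n" by blast
      moreover have "(u, snd e) \<in> pausing_step G"
        using e verts by (cases e) (simp add: pausing_step_def)
      ultimately show ?thesis by (blast intro: relpow_Suc_I2)
    qed
  qed
qed

lemma gdist_eq_INF_length: "gdist G u v = (INF p\<in>{p. awalk u p v}. ereal (real (length p)))"
proof -
  have "awalk_cost (\<lambda>_. 1) p = real (length p)" for p :: "('a \<times> 'a) list"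
    by (induct p) auto
  then show ?thesis by (simp add: gdist_def \<mu>_def)
qed

lemma gdist_less_Suc_iff:
  assumes "u \<in> pverts G"
  shows "gdist G u v < ereal (real (Suc n)) \<longleftrightarrow> (u, v) \<in> pausing_step G ^^ n"
  unfolding gdist_eq_INF_length INF_less_iff pausing_step_relpow_iff_awalk[OF assms]
  by (auto simp: less_Suc_eq_le)

lemma gdist_nonneg: "0 \<le> gdist G u v"
  unfolding gdist_eq_INF_length by (auto intro: INF_greatest)

lemma gdist_nat_or_infinity: "gdist G u v = \<infinity> \<or> (\<exists>n. gdist G u v = ereal (real n))"
proof (cases "\<exists>p. awalk u p v")
  case True
  then obtain p where p: "awalk u p v" "\<And>q. awalk u q v \<Longrightarrow> length p \<le> length q"
    using ex_has_least_nat[of "\<lambda>p. awalk u p v" _ length] by blast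
  then have "gdist G u v = ereal (real (length p))"
    unfolding gdist_eq_INF_length by (intro INF_eqI) auto
  then show ?thesis by blast
next
  case False
  then show ?thesis by (simp add: gdist_eq_INF_length top_ereal_def)
qed

lemma gdist_self:
  assumes "u \<in> pverts G"
  shows "gdist G u u = 0"
proof -
  have "gdist G u u < ereal (real (Suc 0))"
    using gdist_less_Suc_iff[OF assms, of u 0] by simp
  then show ?thesis
    using gdist_nat_or_infinity[of u u] by (auto simp: zero_ereal_def)
qed

end


section \<open>Counting common vertices of balls\<close>

text \<open>
  The inequality is strict so that every sphere, also the one of radius 0, is the difference of
  two consecutive balls.
\<close>

definition ball :: "'a pair_pre_digraph \<Rightarrow> nat \<Rightarrow> 'a \<Rightarrow> 'a set" where
  "ball G n u = {v \<in> pverts G. gdist G u v < ereal (real n)}"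

lemma ball_mono: "m \<le> n \<Longrightarrow> ball G m u \<subseteq> ball G n u"
  by (force simp: ball_def intro: less_le_trans)

context pair_wf_digraph
begin

lemma ball_0: "ball G 0 u = {}"
  using gdist_nonneg[of u] by (auto simp: ball_def not_less simp flip: zero_ereal_def)

lemma centre_in_ball: "u \<in> pverts G \<Longrightarrow> 0 < n \<Longrightarrow> u \<in> ball G n u"
  by (simp add: ball_def gdist_self)

lemma sphere_eq_ball_diff: "sphere G n u = ball G (Suc n) u - ball G n u"
proof -
  have "gdist G u v = ereal (real n) \<longleftrightarrow>
      gdist G u v < ereal (real (Suc n)) \<and> \<not> gdist G u v < ereal (real n)" for v
    using gdist_nat_or_infinity[of u v] by auto
  then show ?thesis by (auto simp: sphere_def ball_def)
qed

lemma ball_eq_UN_sphere: "ball G n u = (\<Union>i<n. sphere G i u)"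
proof -
  have "gdist G u v < ereal (real n) \<longleftrightarrow> (\<exists>i<n. gdist G u v = ereal (real i))" for v
    using gdist_nat_or_infinity[of u v] by auto
  then show ?thesis by (auto simp: sphere_def ball_def)
qed

end

context pair_fin_digraph
begin

lemma finite_ball: "finite (ball G n u)"
  using pair_finite_verts by (simp add: ball_def)

lemma card_ball_Int_ball:
  "card (ball G i u \<inter> ball G j v) = (\<Sum>a<i. \<Sum>b<j. card (sphere G a u \<inter> sphere G b v))"
proof -
  have fin: "finite (sphere G a u \<inter> sphere G b v)" for a b
    using pair_finite_verts by (simp add: sphere_def)
  have "card (ball G i u \<inter> ball G j v)
      = card (\<Union>(a, b)\<in>{..<i} \<times> {..<j}. sphere G a u \<inter> sphere G b v)"
    by (auto simp: ball_eq_UN_sphere intro: arg_cong[where f = card])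
  also have "\<dots> = (\<Sum>(a, b)\<in>{..<i} \<times> {..<j}. card (sphere G a u \<inter> sphere G b v))"
    by (subst card_UN_disjoint) (auto simp: fin case_prod_unfold, auto simp: sphere_def)
  finally show ?thesis by (simp add: sum.cartesian_product)
qed

text \<open>Inclusion-exclusion for \<open>(A - A') \<inter> (B - B')\<close> with \<open>A' \<subseteq> A\<close> and \<open>B' \<subseteq> B\<close>.\<close>

lemma card_sphere_Int_sphere:
  "int (card (sphere G i u \<inter> sphere G j v)) =
    int (card (ball G (Suc i) u \<inter> ball G (Suc j) v)) - int (card (ball G i u \<inter> ball G (Suc j) v))
    - int (card (ball G (Suc i) u \<inter> ball G j v)) + int (card (ball G i u \<inter> ball G j v))"
proof -
  define A A' B B' where AB: "A = ball G (Suc i) u" "A' = ball G i u"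
    "B = ball G (Suc j) v" "B' = ball G j v"
  have sub: "A' \<subseteq> A" "B' \<subseteq> B" by (simp_all add: AB ball_mono)
  have fin: "finite A" "finite A'" "finite B" "finite B'" by (simp_all add: AB finite_ball)
  have "A \<inter> B = ((A - A') \<inter> (B - B')) \<union> ((A' \<inter> B) \<union> (A \<inter> B'))" using sub by blast
  then have "card (A \<inter> B) = card ((A - A') \<inter> (B - B')) + card ((A' \<inter> B) \<union> (A \<inter> B'))"
    using fin by (simp only:) (rule card_Un_disjoint, auto)
  moreover have "card (A' \<inter> B) + card (A \<inter> B')
      = card ((A' \<inter> B) \<union> (A \<inter> B')) + card ((A' \<inter> B) \<inter> (A \<inter> B'))"
    using fin by (intro card_Un_Int) auto
  moreover have "(A' \<inter> B) \<inter> (A \<inter> B') = A' \<inter> B'" using sub by blast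
  ultimately show ?thesis by (simp add: sphere_eq_ball_diff flip: AB)
qed

lemma distance_regular_iff_ball:
  "distance_regular G \<longleftrightarrow>
    (\<forall>i j. \<forall>u \<in> pverts G. \<forall>v \<in> pverts G. \<forall>u' \<in> pverts G. \<forall>v' \<in> pverts G.
       gdist G u v = gdist G u' v' \<longrightarrow>
       card (ball G i u \<inter> ball G j v) = card (ball G i u' \<inter> ball G j v'))"
    (is "_ \<longleftrightarrow> ?balls")
proof
  assume reg: "distance_regular G"
  show ?balls
    unfolding card_ball_Int_ball
  proof (intro allI ballI impI sum.cong refl)
    fix i j u v u' v' a b
    assume "u \<in> pverts G" "v \<in> pverts G" "u' \<in> pverts G" "v' \<in> pverts G"
      and "gdist G u v = gdist G u' v'"
    with reg show "card (sphere G a u \<inter> sphere G b v) = card (sphere G a u' \<inter> sphere G b v')"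
      unfolding distance_regular_def by blast
  qed
next
  assume balls: ?balls
  have "int (card (sphere G i u \<inter> sphere G j v)) = int (card (sphere G i u' \<inter> sphere G j v'))"
    if uv: "u \<in> pverts G" "v \<in> pverts G" "u' \<in> pverts G" "v' \<in> pverts G"
      and d: "gdist G u v = gdist G u' v'" for i j u v u' v'
  proof -
    have "card (ball G a u \<inter> ball G b v) = card (ball G a u' \<inter> ball G b v')" for a b
      using balls uv d by blast
    then show ?thesis unfolding card_sphere_Int_sphere by simp
  qed
  then show "distance_regular G"
    unfolding distance_regular_def of_nat_eq_iff by blast
qed

end

text \<open>
  The counts in \<open>P\<close> depend only on the distance, and cancelling \<open>c i j\<close> from them gives the counts
  in \<open>G\<close>. Positivity is asked for positive radii only, because a ball of radius 0 is empty.
\<close>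

lemma distance_regular_of_isometry:
  assumes G: "pair_fin_digraph G" and P: "pair_fin_digraph P"
    and f: "\<And>u. u \<in> pverts G \<Longrightarrow> f u \<in> pverts P"
    and isometry: "\<And>u v. u \<in> pverts G \<Longrightarrow> v \<in> pverts G \<Longrightarrow> gdist P (f u) (f v) = gdist G u v"
    and count: "\<And>i j u v. u \<in> pverts G \<Longrightarrow> v \<in> pverts G \<Longrightarrow>
      card (ball P i (f u) \<inter> ball P j (f v)) = card (ball G i u \<inter> ball G j v) * c i j"
    and pos: "\<And>i j. 0 < i \<Longrightarrow> 0 < j \<Longrightarrow> 0 < (c i j :: nat)"
    and reg: "distance_regular P"
  shows "distance_regular G"
proof -
  interpret G: pair_fin_digraph G by fact
  interpret P: pair_fin_digraph P by fact
  show ?thesis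
    unfolding G.distance_regular_iff_ball
  proof (intro allI ballI impI)
    fix i j u v u' v'
    assume uv: "u \<in> pverts G" "v \<in> pverts G" "u' \<in> pverts G" "v' \<in> pverts G"
      and d: "gdist G u v = gdist G u' v'"
    show "card (ball G i u \<inter> ball G j v) = card (ball G i u' \<inter> ball G j v')"
    proof (cases "0 < i \<and> 0 < j")
      case True
      have "gdist P (f u) (f v) = gdist P (f u') (f v')"
        using uv d by (simp add: isometry)
      then have "card (ball P i (f u) \<inter> ball P j (f v)) = card (ball P i (f u') \<inter> ball P j (f v'))"
        using reg uv f unfolding P.distance_regular_iff_ball by blast
      then show ?thesis using uv pos[of i j] True by (simp add: count)
    next
      case False
      then show ?thesis by (auto simp: G.ball_0)
    qed
  qed
qed


section \<open>Balls in the strong product\<close>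

lemma relpow_product:
  fixes R :: "('a \<times> 'a) set" and S :: "('b \<times> 'b) set" and T :: "(('a \<times> 'b) \<times> ('a \<times> 'b)) set"
  assumes "\<And>a b c d. ((a, b), (c, d)) \<in> T \<longleftrightarrow> (a, c) \<in> R \<and> (b, d) \<in> S"
  shows "((a, b), (c, d)) \<in> T ^^ n \<longleftrightarrow> (a, c) \<in> R ^^ n \<and> (b, d) \<in> S ^^ n"
  by (induct n arbitrary: c d) (auto simp: assms relcomp_unfold)

lemma pverts_strong_product: "pverts (G \<boxtimes> H) = pverts G \<times> pverts H"
  by (simp add: strong_product_def)

lemma pausing_step_strong_product:
  "((a, b), (c, d)) \<in> pausing_step (G \<boxtimes> H) \<longleftrightarrow>
    (a, c) \<in> pausing_step G \<and> (b, d) \<in> pausing_step H"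
  by (auto simp: pausing_step_def strong_product_def)

locale strong_product_of_pair_graphs =
  G: pair_graph G + H: pair_graph H
  for G :: "'a pair_pre_digraph" and H :: "'b pair_pre_digraph"
begin

sublocale P: pair_graph "G \<boxtimes> H"
  by (rule pair_graph_strong_product) unfold_locales

text \<open>
  In \<open>n\<close> steps with pauses, both coordinates can be moved simultaneously and independently.
\<close>

lemma gdist_strong_product:
  assumes "g \<in> pverts G" "h \<in> pverts H"
  shows "gdist (G \<boxtimes> H) (g, h) (g', h') = max (gdist G g g') (gdist H h h')" (is "?d = ?m")
proof -
  have less: "?d < ereal (real (Suc n)) \<longleftrightarrow> ?m < ereal (real (Suc n))" for n
    using assms relpow_product[OF pausing_step_strong_product, of g h g' h' n G H]
    by (simp only: P.gdist_less_Suc_iff G.gdist_less_Suc_iff H.gdist_less_Suc_iff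
        pverts_strong_product mem_Times_iff fst_conv snd_conv max_less_iff_conj)
  have d: "?d = \<infinity> \<or> (\<exists>n. ?d = ereal (real n))"
    by (rule P.gdist_nat_or_infinity)
  have "?m = gdist G g g' \<or> ?m = gdist H h h'"
    by (simp add: max_def)
  then have m: "?m = \<infinity> \<or> (\<exists>n. ?m = ereal (real n))"
    using G.gdist_nat_or_infinity[of g g'] H.gdist_nat_or_infinity[of h h'] by metis
  from d m less show ?thesis by (rule nat_or_infinity_eqI)
qed

lemma ball_strong_product:
  assumes "g \<in> pverts G" "h \<in> pverts H"
  shows "ball (G \<boxtimes> H) n (g, h) = ball G n g \<times> ball H n h"
  using assms by (auto simp: ball_def gdist_strong_product pverts_strong_product)

lemma card_ball_Int_ball_strong_product:
  assumes "g \<in> pverts G" "h \<in> pverts H" "g' \<in> pverts G" "h' \<in> pverts H"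
  shows "card (ball (G \<boxtimes> H) i (g, h) \<inter> ball (G \<boxtimes> H) j (g', h')) =
    card (ball G i g \<inter> ball G j g') * card (ball H i h \<inter> ball H j h')"
  using assms by (simp add: ball_strong_product Times_Int_Times card_cartesian_product)

lemma distance_regular_left:
  assumes "distance_regular (G \<boxtimes> H)" and h: "h \<in> pverts H"
  shows "distance_regular G"
proof (rule distance_regular_of_isometry[where f = "\<lambda>u. (u, h)" and P = "G \<boxtimes> H"
      and c = "\<lambda>i j. card (ball H i h \<inter> ball H j h)"])
  show "0 < card (ball H i h \<inter> ball H j h)" if "0 < i" "0 < j" for i j
    using that H.centre_in_ball[OF h] by (auto simp: card_gt_0_iff H.finite_ball)
  show "gdist (G \<boxtimes> H) (u, h) (v, h) = gdist G u v" if "u \<in> pverts G" for u v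
    using that h by (simp add: gdist_strong_product H.gdist_self G.gdist_nonneg)
  show "card (ball (G \<boxtimes> H) i (u, h) \<inter> ball (G \<boxtimes> H) j (v, h))
      = card (ball G i u \<inter> ball G j v) * card (ball H i h \<inter> ball H j h)"
    if "u \<in> pverts G" "v \<in> pverts G" for i j u v
    by (rule card_ball_Int_ball_strong_product) (simp_all add: that h)
  show "(u, h) \<in> pverts (G \<boxtimes> H)" if "u \<in> pverts G" for u
    using that h by (simp add: pverts_strong_product)
qed (rule G.pair_fin_digraph_axioms P.pair_fin_digraph_axioms assms(1))+

lemma distance_regular_right:
  assumes "distance_regular (G \<boxtimes> H)" and g: "g \<in> pverts G"
  shows "distance_regular H"
proof (rule distance_regular_of_isometry[where f = "\<lambda>u. (g, u)" and P = "G \<boxtimes> H"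
      and c = "\<lambda>i j. card (ball G i g \<inter> ball G j g)"])
  show "0 < card (ball G i g \<inter> ball G j g)" if "0 < i" "0 < j" for i j
    using that G.centre_in_ball[OF g] by (auto simp: card_gt_0_iff G.finite_ball)
  show "gdist (G \<boxtimes> H) (g, u) (g, v) = gdist H u v" if "u \<in> pverts H" for u v
    using that g by (simp add: gdist_strong_product G.gdist_self H.gdist_nonneg)
  show "card (ball (G \<boxtimes> H) i (g, u) \<inter> ball (G \<boxtimes> H) j (g, v))
      = card (ball H i u \<inter> ball H j v) * card (ball G i g \<inter> ball G j g)"
    if "u \<in> pverts H" "v \<in> pverts H" for i j u v
    by (subst mult.commute, rule card_ball_Int_ball_strong_product) (simp_all add: that g)
  show "(g, u) \<in> pverts (G \<boxtimes> H)" if "u \<in> pverts H" for u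
    using that g by (simp add: pverts_strong_product)
qed (rule H.pair_fin_digraph_axioms P.pair_fin_digraph_axioms assms(1))+

end

text \<open>
  Connectedness provides a vertex in each factor, hence a layer isometric to the other factor.
\<close>

theorem theorem3p10:
  fixes G :: "'a pair_pre_digraph" and H :: "'b pair_pre_digraph"
  assumes "pair_graph G" and "connected (with_proj G)"
    and "pair_graph H" and "connected (with_proj H)"
    and "distance_regular (G \<boxtimes> H)"
  shows "distance_regular G \<and> distance_regular H"
proof -
  interpret strong_product_of_pair_graphs G H
    using assms(1,3) by (simp add: strong_product_of_pair_graphs_def)
  have "pverts G \<noteq> {}" "pverts H \<noteq> {}"
    using assms(2,4) by (simp_all add: connected_def strongly_connected_def)
  then obtain g h where "g \<in> pverts G" "h \<in> pverts H" by blast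
  then show ?thesis
    using distance_regular_left[OF assms(5)] distance_regular_right[OF assms(5)] by simp
qed

end
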